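(* Let $G=(V,E)$ be a graph. The following are equivalent: (1) $G$ is chordal; (2) the induced tree polytope of $G$ is equal to $\mathcal{T}(G)$; (3) $\mathcal{T}(G)$ is bounded. Moreover, when $G$ is chordal, $\mathcal{T}(G)$ is described by a linear system of size $O(|V|\,|\mathcal{K}_G|)$, where $\mathcal{K}_G$ is the set of inclusion-wise maximal cliques of $G$.
   Context: All graphs are finite and simple. A hole is an induced cycle of length at least 4; a graph is chordal if it has no hole. A clique is a set of pairwise adjacent vertices. A tree is a connected acyclic graph. An induced tree of $G$ is a vertex set $W\subseteq V$ such that the induced subgraph $G[W]$ is a tree. $E(W)$ is the set of edges of $G$ with both endpoints in $W$. The extended incidence vector of $W\subseteq V$ is $\xi^W=(\chi^W,\zeta^{E(W)})\in\{0,1\}^V\times\{0,1\}^E$, where $\chi^W$ and $\zeta^{E(W)}$ are the 0/1 indicator vectors of $W$ and $E(W)$. The induced tree polytope of $G$ is $\mathrm{conv}\{\xi^W: W \text{ is an induced tree of } G\}$. For $v\in V$, $\Omega^v$ denotes the set of inclusion-wise maximal cliques of $G$ containing $v$. $\mathcal{C}_T(G)$ is the cone of all $(x,y)\in\mathbb{R}^V\times\mathbb{R}^E$ satisfying $$\sum_{u\in K\setminus\{v\}} y_{uv}\le x_v\quad \forall v\in V,\ K\in\Omega^v;\qquad -x_v\le 0\quad\forall v\in V;\qquad -y_e\le 0\quad\forall e\in E.$$ $\mathcal{T}(G)$ is the intersection of $\mathcal{C}_T(G)$ with the hyperplane $\{(x,y): \sum_{v\in V}x_v-\sum_{e\in E}y_e=1\}$.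 The size of a linear system is its number of rows.
   Formalization: The size bound does not count the rows -x_v ≤ 0 and -y_e ≤ 0 and assumes V nonempty: counting all rows it fails for complete graphs K_n, where T(G) is a simplex with n+n(n-1)/2 facets but |V||K_G| = n. *)

theory Defs
  imports "HOL-Analysis.Analysis" "HOL-Analysis.Finite_Function_Topology" "HOL-Library.Ramsey"
begin

section \<open>Graphs\<close>

text \<open>
  A finite simple graph is a vertex set together with a set of two-element subsets of it.
  The vertex type is arbitrary, so that uniform bounds over all finite graphs can be stated.
\<close>

definition simple_graph :: "'v set \<Rightarrow> 'v set set \<Rightarrow> bool" where
  "simple_graph V E \<longleftrightarrow> finite V \<and> E \<subseteq> [V]\<^bsup>2\<^esup>"

definition induced_edges :: "'v set set \<Rightarrow> 'v set \<Rightarrow> 'v set set" where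
  "induced_edges E W = {e \<in> E. e \<subseteq> W}"

definition cycle_edges :: "'v list \<Rightarrow> 'v set set" where
  "cycle_edges p = {{p ! i, p ! (Suc i mod length p)} | i. i < length p}"

definition is_cycle :: "'v set set \<Rightarrow> 'v list \<Rightarrow> bool" where
  "is_cycle E p \<longleftrightarrow> length p \<ge> 3 \<and> distinct p \<and> cycle_edges p \<subseteq> E"

definition is_hole :: "'v set set \<Rightarrow> 'v list \<Rightarrow> bool" where
  "is_hole E p \<longleftrightarrow> is_cycle E p \<and> length p \<ge> 4 \<and> induced_edges E (set p) = cycle_edges p"

definition chordal :: "'v set set \<Rightarrow> bool" where
  "chordal E \<longleftrightarrow> (\<nexists>p. is_hole E p)"

definition connected_graph :: "'v set \<Rightarrow> 'v set set \<Rightarrow> bool" where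
  "connected_graph V E \<longleftrightarrow> V \<noteq> {} \<and> (\<forall>u\<in>V. \<forall>v\<in>V. (\<lambda>a b. {a, b} \<in> E)\<^sup>*\<^sup>* u v)"

definition acyclic_graph :: "'v set set \<Rightarrow> bool" where
  "acyclic_graph E \<longleftrightarrow> (\<nexists>p. is_cycle E p)"

definition is_tree :: "'v set \<Rightarrow> 'v set set \<Rightarrow> bool" where
  "is_tree V E \<longleftrightarrow> connected_graph V E \<and> acyclic_graph E"

definition induced_tree :: "'v set \<Rightarrow> 'v set set \<Rightarrow> 'v set \<Rightarrow> bool" where
  "induced_tree V E W \<longleftrightarrow> W \<subseteq> V \<and> is_tree W (induced_edges E W)"

definition maximal_cliques :: "'v set \<Rightarrow> 'v set set \<Rightarrow> 'v set set" where
  "maximal_cliques V E =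
     {K. K \<subseteq> V \<and> clique K E \<and> (\<forall>K'. K' \<subseteq> V \<longrightarrow> clique K' E \<longrightarrow> K \<subseteq> K' \<longrightarrow> K' = K)}"

definition maximal_cliques_at :: "'v set \<Rightarrow> 'v set set \<Rightarrow> 'v \<Rightarrow> 'v set set" where
  "maximal_cliques_at V E v = {K \<in> maximal_cliques V E. v \<in> K}"


section \<open>The polyhedra\<close>

text \<open>
  Vectors are pairs of finitely supported functions on vertices and on edges; the space
  \<open>\<real>\<^sup>V \<times> \<real>\<^sup>E\<close> is the coordinate subspace of the pairs supported on \<open>V\<close> and \<open>E\<close>.
\<close>

type_synonym 'v ve_vec = "('v \<Rightarrow>\<^sub>0 real) \<times> ('v set \<Rightarrow>\<^sub>0 real)"

definition ve_space :: "'v set \<Rightarrow> 'v set set \<Rightarrow> 'v ve_vec set" where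
  "ve_space V E = {(x, y). Poly_Mapping.keys x \<subseteq> V \<and> Poly_Mapping.keys y \<subseteq> E}"

definition ind_vec :: "'a set \<Rightarrow> 'a \<Rightarrow>\<^sub>0 real" where
  "ind_vec A = (\<Sum>a\<in>A. Poly_Mapping.single a 1)"

lemma lookup_ind_vec:
  "finite A \<Longrightarrow> Poly_Mapping.lookup (ind_vec A) a = (if a \<in> A then 1 else 0)"
  by (simp add: ind_vec_def lookup_sum lookup_single when_def)

definition ext_incidence :: "'v set set \<Rightarrow> 'v set \<Rightarrow> 'v ve_vec" where
  "ext_incidence E W = (ind_vec W, ind_vec (induced_edges E W))"

definition induced_tree_polytope :: "'v set \<Rightarrow> 'v set set \<Rightarrow> 'v ve_vec set" where
  "induced_tree_polytope V E = convex hull {ext_incidence E W | W. induced_tree V E W}"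

definition cone_T :: "'v set \<Rightarrow> 'v set set \<Rightarrow> 'v ve_vec set" where
  "cone_T V E = {(x, y) \<in> ve_space V E.
     (\<forall>v\<in>V. \<forall>K\<in>maximal_cliques_at V E v.
        (\<Sum>u\<in>K - {v}. Poly_Mapping.lookup y {u, v}) \<le> Poly_Mapping.lookup x v) \<and>
     (\<forall>v\<in>V. - Poly_Mapping.lookup x v \<le> 0) \<and>
     (\<forall>e\<in>E. - Poly_Mapping.lookup y e \<le> 0)}"

definition poly_T :: "'v set \<Rightarrow> 'v set set \<Rightarrow> 'v ve_vec set" where
  "poly_T V E = cone_T V E \<inter>
     {(x, y). (\<Sum>v\<in>V. Poly_Mapping.lookup x v) - (\<Sum>e\<in>E. Poly_Mapping.lookup y e) = 1}"


section \<open>Linear systems\<close>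

text \<open>
  A row \<open>((a, b), c)\<close> stands for the inequality \<open>a \<bullet> x + b \<bullet> y \<le> c\<close>; an equation is a pair
  of opposite rows.
\<close>

type_synonym 'v row = "'v ve_vec \<times> real"

definition satisfies_row :: "'v set \<Rightarrow> 'v set set \<Rightarrow> 'v ve_vec \<Rightarrow> 'v row \<Rightarrow> bool" where
  "satisfies_row V E = (\<lambda>(x, y) ((a, b), c).
     (\<Sum>v\<in>V. Poly_Mapping.lookup a v * Poly_Mapping.lookup x v) +
     (\<Sum>e\<in>E. Poly_Mapping.lookup b e * Poly_Mapping.lookup y e) \<le> c)"

definition solution_set :: "'v set \<Rightarrow> 'v set set \<Rightarrow> 'v row set \<Rightarrow> 'v ve_vec set" where
  "solution_set V E S = {z \<in> ve_space V E. \<forall>r\<in>S. satisfies_row V E z r}"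

definition sign_rows :: "'v set \<Rightarrow> 'v set set \<Rightarrow> 'v row set" where
  "sign_rows V E = {((- Poly_Mapping.single v 1, 0), 0) | v. v \<in> V} \<union>
                   {((0, - Poly_Mapping.single e 1), 0) | e. e \<in> E}"

text \<open>
  The size is the number of rows of the constraint matrix, where the sign restrictions
  \<open>-x\<^sub>v \<le> 0\<close> and \<open>-y\<^sub>e \<le> 0\<close> are bounds on the variables and not counted (there are at most
  \<open>|V| + |E|\<close> of them). With those counted, no bound \<open>O(|V| |\<K>|)\<close> for chordal graphs could
  hold: for the complete graph on \<open>n\<close> vertices the polytope is a simplex with
  \<open>n + n(n-1)/2\<close> facets, while \<open>|V| |\<K>| = n\<close>.
\<close>

definition system_size :: "'v set \<Rightarrow> 'v set set \<Rightarrow> 'v row set \<Rightarrow> nat" where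
  "system_size V E S = card (S - sign_rows V E)"

end

theory Submission
  imports Defs
begin

text \<open>
  Every point of the cone of a chordal graph is a nonnegative combination of tree vectors, by
  induction along a simplicial elimination order: a simplicial vertex is attached as a leaf to
  suitable fractions of the trees that meet its neighbourhood in a single vertex. As
  \<open>|W| - |E(W)| = 1\<close> on trees, the hyperplane turns conic into convex combinations. Conversely, the
  incidence vector of a hole lies in the cone and satisfies \<open>\<Sum>x - \<Sum>y = 0\<close>, so it is a direction of
  unboundedness.
\<close>

section \<open>Shortest paths and cycles\<close>

text \<open>Two features shape the induction. A maximal clique of an induced subgraph need not be
  maximal in the graph, so the inequalities are carried for all cliques; nonnegativity of
  \<open>y\<close> yields them from the maximal ones. And the restriction of a point to fewer
  vertices need not stay on the hyperplane, so the weights are conic and are normalised only at the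
  very end. Simpliciality is what makes the extension step computable: the neighbourhood is a
  clique, and a tree contains at most two vertices of a clique. Inclusion-exclusion over the
  neighbourhood therefore stops at pairs, and the pairs are edges, whose total weights are exactly
  the data in \<open>y\<close>. For larger intersections, or for nonadjacent pairs,
  \<open>(x, y)\<close> would not determine how much tree weight can accept the new leaf. Trees and
  holes lie in the cone for one common reason, the absence of triangles; they are told apart by the
  value of \<open>|W| - |E(W)|\<close> alone.\<close>

lemma successively_nthD: "successively P p \<Longrightarrow> Suc i < length p \<Longrightarrow> P (p ! i) (p ! Suc i)"
proof (induction p arbitrary: i)
  case (Cons x p)
  then show ?case
    by (cases i) (auto simp: successively_Cons hd_conv_nth)
qed simp

text \<open>In a walk of least length, a repeated vertex or an edge that jumps ahead would allow a
  shortcut. Only pairs \<open>i < j\<close> are considered because \<open>R\<close> is not assumed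
  symmetric; for an adjacency relation the result is an induced path.\<close>

lemma rtranclp_imp_induced_path:
  assumes "R\<^sup>*\<^sup>* a b"
  shows "\<exists>p. p \<noteq> [] \<and> hd p = a \<and> last p = b \<and> successively R p \<and> distinct p \<and>
    (\<forall>j<length p. \<forall>i<j. R (p ! i) (p ! j) \<longrightarrow> j = Suc i)"
proof -
  define walk where "walk p \<longleftrightarrow> p \<noteq> [] \<and> hd p = a \<and> last p = b \<and> successively R p" for p
  have "\<exists>p. p \<noteq> [] \<and> hd p = a \<and> last p = b \<and> successively R p"
    using assms
  proof (induction rule: rtranclp_induct)
    case base
    then show ?case
      by (intro exI[of _ "[a]"]) auto
  next
    case (step y z)
    then obtain p where "p \<noteq> []" "hd p = a" "last p = y" "successively R p" "R y z"
      by blast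
    then show ?case
      by (intro exI[of _ "p @ [z]"]) (auto simp: successively_append_iff)
  qed
  then have "\<exists>p. walk p"
    unfolding walk_def .
  then obtain p where p: "walk p" and min: "\<And>q. walk q \<Longrightarrow> length p \<le> length q"
    using arg_min_natI[of walk] arg_min_nat_le[of walk] by metis
  have last_take: "last (take (Suc i) p) = p ! i" if "i < length p" for i
    using that by (simp add: take_Suc_conv_app_nth)
  have shortcut: "walk (take (Suc i) p @ drop j p)"
    if "i < j" "j < length p" "R (p ! i) (p ! j)" for i j
  proof -
    have "successively R (take (Suc i) p @ drop (Suc i) p)" "successively R (take j p @ drop j p)"
      using p by (simp_all add: walk_def)
    then have "successively R (take (Suc i) p)" "successively R (drop j p)"
      unfolding successively_append_iff by blast+
    then show ?thesis
      using p that by (auto simp: walk_def successively_append_iff last_take hd_drop_conv_nth)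
  qed
  have "j = Suc i" if "i < j" "j < length p" "R (p ! i) (p ! j)" for i j
    using min[OF shortcut[OF that]] that by simp
  moreover have "distinct p"
  proof (rule ccontr)
    assume "\<not> distinct p"
    then obtain i j where ij: "i < j" "j < length p" "p ! i = p ! j"
      unfolding distinct_conv_nth by (metis linorder_neqE_nat)
    have suc: "successively R (take (Suc i) p @ drop (Suc i) p)"
      "successively R (take (Suc j) p @ drop (Suc j) p)"
      using p by (simp_all add: walk_def)
    \<comment> \<open>The loop between two visits of the same vertex is cut out. If the second visit
      ends the walk, the remaining tail is empty and has no head to connect to, hence the case
      split.\<close>
    have "walk (take (Suc i) p @ drop (Suc j) p)"
    proof (cases "Suc j = length p")
      case True
      then have "last p = p ! j"
        using p by (metis diff_Suc_1 last_conv_nth walk_def)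
      then show ?thesis
        using p ij True suc unfolding successively_append_iff
        by (auto simp: walk_def last_take)
    next
      case False
      have "R (p ! j) (p ! Suc j)"
        using suc(2) ij False unfolding successively_append_iff
        by (auto simp: last_take hd_drop_conv_nth)
      then show ?thesis
        using p ij False suc unfolding successively_append_iff
        by (auto simp: walk_def last_take hd_drop_conv_nth successively_append_iff)
    qed
    from min[OF this] ij show False
      by simp
  qed
  ultimately show ?thesis
    using p unfolding walk_def by blast
qed

section \<open>Edge sets of cyclic vertex lists\<close>

lemma cycle_edges_conv_image:
  "cycle_edges p = (\<lambda>i. {p ! i, p ! (Suc i mod length p)}) ` {..<length p}"
  unfolding cycle_edges_def by auto

text \<open>Splitting off one vertex replaces indices modulo the length by plain consecutive ones.
  The cycles and holes constructed below all arise as a path closed by one further vertex.\<close>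

lemma cycle_edges_Cons:
  assumes "p \<noteq> []"
  shows "cycle_edges (w # p) =
    insert {w, hd p} (insert {last p, w} {{p ! i, p ! Suc i} | i. Suc i < length p})"
proof -
  obtain m where m: "length p = Suc m"
    using assms by (cases p) auto
  have "cycle_edges (w # p) = insert {w, p ! 0} (insert {p ! m, w}
      ((\<lambda>i. {p ! i, (w # p) ! (Suc (Suc i) mod Suc (Suc m))}) ` {..<m}))"
    unfolding cycle_edges_conv_image
    by (simp only: m list.size(4) add_Suc_right add_0_right One_nat_def
        lessThan_Suc_eq_insert_0[of "Suc m"] lessThan_Suc[of m] image_insert image_image) simp
  also have "(\<lambda>i. {p ! i, (w # p) ! (Suc (Suc i) mod Suc (Suc m))}) ` {..<m} =
      (\<lambda>i. {p ! i, p ! Suc i}) ` {..<m}"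
    by (rule image_cong) auto
  also have "\<dots> = {{p ! i, p ! Suc i} | i. Suc i < length p}"
    using m by auto
  finally show ?thesis
    using assms m by (simp add: last_conv_nth hd_conv_nth)
qed

lemma cycle_edge_iff:
  assumes "distinct p" "i < length p" "j < length p"
  shows "{p ! i, p ! j} \<in> cycle_edges p \<longleftrightarrow>
    j = Suc i mod length p \<or> i = Suc j mod length p"
proof -
  have "Suc k mod length p < length p" for k
    using assms by (intro mod_less_divisor) auto
  then show ?thesis
    using assms unfolding cycle_edges_def
    by (auto simp: doubleton_eq_iff nth_eq_iff_index_eq)
qed

lemma card_cycle_edges:
  assumes "distinct p" "length p \<ge> 3"
  shows "card (cycle_edges p) = length p"
proof -
  have "inj_on (\<lambda>i. {p ! i, p ! (Suc i mod length p)}) {..<length p}"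
  proof (rule inj_onI)
    fix i j
    assume ij: "i \<in> {..<length p}" "j \<in> {..<length p}"
      "{p ! i, p ! (Suc i mod length p)} = {p ! j, p ! (Suc j mod length p)}"
    have "Suc k mod length p < length p" for k
      using assms by (intro mod_less_divisor) auto
    \<comment> \<open>Distinct positions give the same edge only if each is the cyclic successor of
      the other, which forces length 2.\<close>
    then have "i = j \<or> i = Suc j mod length p \<and> j = Suc i mod length p"
      using ij assms by (auto simp: doubleton_eq_iff nth_eq_iff_index_eq)
    then show "i = j"
      using ij assms by (auto simp: mod_Suc split: if_splits)
  qed
  then have "card ((\<lambda>i. {p ! i, p ! (Suc i mod length p)}) ` {..<length p}) = length p"
    by (simp add: card_image)
  then show ?thesis
    by (simp add: cycle_edges_conv_image)
qed

lemma cycle_edges_subset: "e \<in> cycle_edges p \<Longrightarrow> e \<subseteq> set p"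
  unfolding cycle_edges_def
  by (auto intro!: nth_mem mod_less_divisor)

lemma is_cycle_two_neighbours:
  assumes "is_cycle E p" "s \<in> set p"
  obtains a b where "a \<noteq> b" "a \<noteq> s" "b \<noteq> s" "{s, a} \<in> E" "{s, b} \<in> E" "a \<in> set p" "b \<in> set p"
proof -
  obtain i where i: "i < length p" "p ! i = s"
    using assms(2) by (metis in_set_conv_nth)
  let ?n = "length p"
  \<comment> \<open>Cyclic successor and predecessor of \<open>i\<close>. The wrap at 0 is written
    out, since truncated subtraction would return 0. The two differ because the length is at least
    3.\<close>
  let ?a = "Suc i mod ?n" and ?b = "if i = 0 then ?n - 1 else i - 1"
  have p: "?n \<ge> 3" "distinct p" "cycle_edges p \<subseteq> E"
    using assms by (auto simp: is_cycle_def)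
  have bounds: "?a < ?n" "?b < ?n" "Suc ?b mod ?n = i"
    using p i by (auto intro: mod_less_divisor)
  have "?a \<noteq> ?b" "?a \<noteq> i" "?b \<noteq> i"
    using p i by (auto simp: mod_Suc)
  then have "p ! ?a \<noteq> p ! ?b" "p ! ?a \<noteq> s" "p ! ?b \<noteq> s"
    using p i bounds by (auto simp: nth_eq_iff_index_eq)
  moreover have "{s, p ! ?a} \<in> E"
    using p i unfolding cycle_edges_def by blast
  moreover have "{p ! i, p ! ?b} \<in> cycle_edges p"
    using cycle_edge_iff[OF p(2) i(1) bounds(2)] bounds(3) by simp
  then have "{s, p ! ?b} \<in> E"
    using p i by blast
  moreover have "p ! ?a \<in> set p" "p ! ?b \<in> set p"
    using bounds by auto
  ultimately show ?thesis
    using that by blast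
qed

lemma is_cycle_path_Cons:
  assumes "p \<noteq> []" "distinct p" "successively (\<lambda>a b. {a, b} \<in> E) p"
    and "w \<notin> set p" "{w, hd p} \<in> E" "{w, last p} \<in> E" "hd p \<noteq> last p"
  shows "is_cycle E (w # p)"
proof -
  have "length p \<ge> 2"
    using assms(1,7) by (cases p rule: list.exhaust; cases "tl p") auto
  moreover have "{p ! i, p ! Suc i} \<in> E" if "Suc i < length p" for i
    using assms(3) that by (rule successively_nthD)
  then have "cycle_edges (w # p) \<subseteq> E"
    using assms by (auto simp: cycle_edges_Cons insert_commute)
  ultimately show ?thesis
    using assms by (simp add: is_cycle_def)
qed

section \<open>Simplicial vertices\<close>

lemma card2_no_loop: "(\<And>e. e \<in> E \<Longrightarrow> card e = 2) \<Longrightarrow> {a} \<notin> E"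
  by fastforce

text \<open>An edge among these vertices either meets \<open>v\<close>, and then ends in an end of
  the path, or joins two path vertices, and then is a path edge. With three path vertices the closed
  cycle has length at least 4; with two it would be a triangle.\<close>

lemma is_hole_Cons_induced_path:
  assumes E2: "\<And>e. e \<in> E \<Longrightarrow> card e = 2"
    and p: "successively (\<lambda>a b. {a, b} \<in> E) p" "distinct p" "length p \<ge> 3"
    and chordless: "\<And>i j. i < j \<Longrightarrow> j < length p \<Longrightarrow> {p ! i, p ! j} \<in> E \<Longrightarrow> j = Suc i"
    and v: "v \<notin> set p" "\<And>x. x \<in> set p \<Longrightarrow> {v, x} \<in> E \<longleftrightarrow> x = hd p \<or> x = last p"
  shows "is_hole E (v # p)"
proof -
  have [simp]: "p \<noteq> []"
    using p by auto
  have ends: "hd p = p ! 0" "last p = p ! (length p - 1)"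
    by (simp_all add: hd_conv_nth last_conv_nth)
  have "p ! 0 \<noteq> p ! (length p - 1)"
    using p by (subst nth_eq_iff_index_eq) auto
  then have cycle: "is_cycle E (v # p)"
    using p v ends by (intro is_cycle_path_Cons) auto
  have "e \<in> cycle_edges (v # p)" if asm: "e \<in> E" "e \<subseteq> insert v (set p)" for e
  proof -
    obtain x y where e: "e = {x, y}" "x \<noteq> y"
      using E2[OF asm(1)] by (auto simp: card_2_iff)
    have *: "{v, z} \<in> cycle_edges (v # p)" if "z \<in> set p" "{v, z} \<in> E" for z
      using that v(2)[of z] by (auto simp: cycle_edges_Cons insert_commute)
    have **: "{p ! i, p ! j} \<in> cycle_edges (v # p)"
      if "i < j" "j < length p" "{p ! i, p ! j} \<in> E" for i j
      using that chordless[OF that] by (auto simp: cycle_edges_Cons)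
    show ?thesis
    proof (cases "v \<in> e")
      case True
      then obtain z where "e = {v, z}" "z \<noteq> v"
        using e by auto
      then show ?thesis
        using * asm by auto
    next
      case False
      then obtain i j where "x = p ! i" "y = p ! j" "i < length p" "j < length p" "i \<noteq> j"
        using asm e by (auto simp: in_set_conv_nth)
      then show ?thesis
        using **[of i j] **[of j i] asm e by (cases "i < j") (auto simp: insert_commute)
    qed
  qed
  moreover have "cycle_edges (v # p) \<subseteq> induced_edges E (set (v # p))"
    using cycle cycle_edges_subset[of _ "v # p"] by (auto simp: is_cycle_def induced_edges_def)
  ultimately show ?thesis
    using cycle p by (auto simp: is_hole_def induced_edges_def)
qed

text \<open>Dirac's argument: the neighbourhood \<open>S\<close> of a component \<open>C\<close> of \<open>W - N[v]\<close> is a clique,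
  as a shortest path through \<open>C\<close> between nonadjacent members of \<open>S\<close> closes up with \<open>v\<close> to a hole.\<close>

lemma chordal_simplicial_nonneighbour:
  assumes E2: "\<And>e. e \<in> E \<Longrightarrow> card e = 2" and "chordal E"
    and "finite W" "v \<in> W" "u \<in> W" "u \<noteq> v" "{u, v} \<notin> E"
  shows "\<exists>w\<in>W. w \<noteq> v \<and> {w, v} \<notin> E \<and> clique {x \<in> W. {x, w} \<in> E} E"
  using assms(3-)
proof (induction W arbitrary: v u rule: finite_psubset_induct)
  case (psubset W)
  define M where "M = {w \<in> W. w \<noteq> v \<and> {w, v} \<notin> E}"
  define R where "R a b \<longleftrightarrow> a \<in> M \<and> b \<in> M \<and> {a, b} \<in> E" for a b
  define C where "C = {c. R\<^sup>*\<^sup>* u c}"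
  define S where "S = {s \<in> W. {s, v} \<in> E \<and> (\<exists>c\<in>C. {s, c} \<in> E)}"
  have "u \<in> M"
    using psubset.prems by (simp add: M_def)
  then have "C \<subseteq> M"
    by (auto simp: C_def R_def elim: rtranclp.cases)
  have "u \<in> C"
    by (simp add: C_def)
  have closed: "d \<in> C \<union> S" if "c \<in> C" "d \<in> W" "{d, c} \<in> E" for c d
  proof (cases "d = v \<or> {d, v} \<in> E")
    case True
    then show ?thesis
      using that \<open>C \<subseteq> M\<close> by (auto simp: S_def M_def insert_commute)
  next
    case False
    then have "R c d"
      using that \<open>C \<subseteq> M\<close> by (auto simp: R_def M_def insert_commute)
    then show ?thesis
      using that(1) by (auto simp: C_def)
  qed
  have "clique S E"
  proof (rule ccontr)
    assume "\<not> clique S E"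
    then obtain a b where ab: "a \<in> S" "b \<in> S" "a \<noteq> b" "{a, b} \<notin> E"
      by (auto simp: clique_def)
    then obtain c d where cd: "c \<in> C" "d \<in> C" "{a, c} \<in> E" "{b, d} \<in> E"
      by (auto simp: S_def)
    \<comment> \<open>The connecting path is confined to \<open>C\<close> and the two ends: its
      interior then consists of nonneighbours of \<open>v\<close>, whereas a detour through other
      vertices of \<open>S\<close> would create chords at \<open>v\<close>.\<close>
    define T where "T = insert a (insert b C)"
    define Q where "Q x y \<longleftrightarrow> x \<in> T \<and> y \<in> T \<and> {x, y} \<in> E" for x y
    have "symp Q"
      by (auto simp: symp_def Q_def insert_commute)
    have "Q\<^sup>*\<^sup>* u x" if "R\<^sup>*\<^sup>* u x" for x
      using that
    proof (induction rule: rtranclp_induct)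
      case (step y z)
      then have "y \<in> C" "z \<in> C"
        by (auto simp: C_def)
      then have "Q y z"
        using step by (auto simp: Q_def T_def R_def)
      then show ?case
        using step by simp
    qed simp
    then have "Q\<^sup>*\<^sup>* u c" "Q\<^sup>*\<^sup>* u d"
      using cd by (auto simp: C_def)
    moreover have "Q a c" "Q d b"
      using cd by (auto simp: Q_def T_def insert_commute)
    ultimately have "Q\<^sup>*\<^sup>* a c" "Q\<^sup>*\<^sup>* u b"
      by auto
    moreover have "Q\<^sup>*\<^sup>* c u"
      using \<open>Q\<^sup>*\<^sup>* u c\<close> symp_rtranclp[OF \<open>symp Q\<close>] by (blast dest: sympD)
    ultimately have "Q\<^sup>*\<^sup>* a b"
      by (meson rtranclp_trans)
    then obtain p where p: "p \<noteq> []" "hd p = a" "last p = b" "successively Q p" "distinct p"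
      and induced: "\<forall>j<length p. \<forall>i<j. Q (p ! i) (p ! j) \<longrightarrow> j = Suc i"
      using rtranclp_imp_induced_path by meson
    have "p \<noteq> [x]" for x
      using p ab by auto
    then have "length p \<ge> 2"
      using p(1) by (cases p rule: list.exhaust; cases "tl p") auto
    have "set p \<subseteq> T"
    proof
      fix x
      assume "x \<in> set p"
      then obtain i where i: "i < length p" "x = p ! i"
        by (auto simp: in_set_conv_nth)
      show "x \<in> T"
      proof (cases i)
        case 0
        then show ?thesis
          using successively_nthD[OF p(4), of 0] i \<open>length p \<ge> 2\<close> by (auto simp: Q_def)
      next
        case (Suc j)
        then show ?thesis
          using successively_nthD[OF p(4), of j] i by (auto simp: Q_def)
      qed
    qed
    have "is_hole E (v # p)"
    proof (rule is_hole_Cons_induced_path[OF E2])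
      show "successively (\<lambda>a b. {a, b} \<in> E) p"
        by (rule successively_mono[OF p(4)]) (simp add: Q_def)
      have "p \<noteq> [a, b]"
        using p(4) ab by (auto simp: Q_def)
      then have "length p \<noteq> 2"
        using p by (auto simp: numeral_2_eq_2 length_Suc_conv)
      then show "length p \<ge> 3"
        using \<open>length p \<ge> 2\<close> by simp
      show "j = Suc i" if "i < j" "j < length p" "{p ! i, p ! j} \<in> E" for i j
      proof -
        have "p ! i \<in> T" "p ! j \<in> T"
          using that \<open>set p \<subseteq> T\<close> by (meson less_trans nth_mem subsetD)+
        then have "Q (p ! i) (p ! j)"
          using that by (simp add: Q_def)
        then show ?thesis
          using induced that by blast
      qed
      show "v \<notin> set p"
        using \<open>set p \<subseteq> T\<close> \<open>C \<subseteq> M\<close> ab card2_no_loop[OF E2, where a = v]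
        by (auto simp: T_def S_def M_def)
      show "{v, x} \<in> E \<longleftrightarrow> x = hd p \<or> x = last p" if "x \<in> set p" for x
        using that \<open>set p \<subseteq> T\<close> \<open>C \<subseteq> M\<close> ab p
        by (auto simp: T_def S_def M_def insert_commute)
    qed (use p in auto)
    then show False
      using \<open>chordal E\<close> by (simp add: chordal_def)
  qed
  \<comment> \<open>A simplicial vertex of \<open>C \<union> S\<close> is useful only if it lies in
    \<open>C\<close>, where \<open>closed\<close> shows that no neighbour in \<open>W\<close> is
    lost. So the induction hypothesis is applied at a vertex whose nonneighbours all avoid
    \<open>S\<close>: any \<open>s\<close> in \<open>S\<close> qualifies because \<open>S\<close> is
    a clique, and if every such \<open>s\<close> is adjacent to all of \<open>C \<union> S\<close>,
    any \<open>c\<close> in \<open>C\<close> qualifies. If neither has a nonneighbour,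
    \<open>C \<union> S\<close> is a clique and \<open>u\<close> will do.\<close>
  have "\<exists>w\<in>C. clique {x \<in> C \<union> S. {x, w} \<in> E} E"
  proof -
    have "C \<union> S \<subset> W"
      using \<open>C \<subseteq> M\<close> psubset.prems card2_no_loop[OF E2, where a = v] by (auto simp: M_def S_def)
    note IH = psubset.IH[OF this]
    consider (S) s x where "s \<in> S" "x \<in> C \<union> S" "x \<noteq> s" "{x, s} \<notin> E"
      | (C) c x where "\<And>s x. s \<in> S \<Longrightarrow> x \<in> C \<union> S \<Longrightarrow> x \<noteq> s \<Longrightarrow> {x, s} \<in> E"
        "c \<in> C" "x \<in> C \<union> S" "x \<noteq> c" "{x, c} \<notin> E"
      | (all) "clique (C \<union> S) E"
      unfolding clique_def by blast
    then show ?thesis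
    proof cases
      case S
      then obtain w where w: "w \<in> C \<union> S" "w \<noteq> s" "{w, s} \<notin> E" "clique {x \<in> C \<union> S. {x, w} \<in> E} E"
        using IH[of s x] by auto
      then have "w \<notin> S"
        using \<open>clique S E\<close> S by (auto simp: clique_def)
      then show ?thesis
        using w by auto
    next
      case C
      then obtain w where w: "w \<in> C \<union> S" "w \<noteq> c" "{w, c} \<notin> E" "clique {x \<in> C \<union> S. {x, w} \<in> E} E"
        using IH[of c x] by auto
      then have "w \<notin> S"
        using C(1)[of w c] C(2) by (auto simp: insert_commute)
      then show ?thesis
        using w by auto
    next
      case all
      then have "clique {x \<in> C \<union> S. {x, u} \<in> E} E"
        by (rule smaller_clique) blast
      then show ?thesis
        using \<open>u \<in> C\<close> by blast
    qed
  qed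
  then obtain w where w: "w \<in> C" "clique {x \<in> C \<union> S. {x, w} \<in> E} E"
    by blast
  have "{x \<in> W. {x, w} \<in> E} \<subseteq> {x \<in> C \<union> S. {x, w} \<in> E}"
    using closed[OF w(1)] by auto
  with w(2) have "clique {x \<in> W. {x, w} \<in> E} E"
    by (rule smaller_clique)
  then show ?case
    using w(1) \<open>C \<subseteq> M\<close> by (auto simp: M_def)
qed

lemma chordal_simplicial_exists:
  assumes E2: "\<And>e. e \<in> E \<Longrightarrow> card e = 2" and "chordal E" and "finite W" "W \<noteq> {}"
  obtains s where "s \<in> W" "clique {x \<in> W. {x, s} \<in> E} E"
proof (cases "clique W E")
  case True
  obtain s where "s \<in> W"
    using \<open>W \<noteq> {}\<close> by blast
  moreover have "clique {x \<in> W. {x, s} \<in> E} E"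
    using True by (rule smaller_clique) blast
  ultimately show ?thesis
    by (rule that)
next
  case False
  then obtain u v where "u \<in> W" "v \<in> W" "u \<noteq> v" "{u, v} \<notin> E"
    by (auto simp: clique_def)
  then show ?thesis
    using chordal_simplicial_nonneighbour[OF E2 assms(2,3), of v u] that by blast
qed

section \<open>Induced trees\<close>

lemma finite_induced_edges: "finite A \<Longrightarrow> finite (induced_edges E A)"
  by (rule finite_subset[of _ "Pow A"]) (auto simp: induced_edges_def)

lemma is_tree_singleton:
  assumes "\<And>e. e \<in> E \<Longrightarrow> card e = 2"
  shows "is_tree {s} (induced_edges E {s})"
proof -
  have "induced_edges E {s} = {}"
    using assms by (fastforce simp: induced_edges_def subset_singleton_iff)
  moreover have "\<not> is_cycle {} p" for p :: "'a list"
    by (cases p) (auto simp: is_cycle_def cycle_edges_def)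
  ultimately show ?thesis
    by (auto simp: is_tree_def connected_graph_def acyclic_graph_def)
qed

text \<open>A cycle through \<open>s\<close> would need two neighbours of \<open>s\<close>, and a
  cycle avoiding \<open>s\<close> would already lie in \<open>W\<close>.\<close>

lemma is_tree_insert_leaf:
  assumes tree: "is_tree W (induced_edges E W)"
    and s: "s \<notin> W" and nbr: "{w \<in> W. {w, s} \<in> E} = {u}"
  shows "is_tree (insert s W) (induced_edges E (insert s W))"
proof -
  let ?F = "induced_edges E (insert s W)"
  let ?R = "\<lambda>a b. {a, b} \<in> ?F"
  have u: "u \<in> W" "{u, s} \<in> E"
    using nbr by auto
  have "?R\<^sup>*\<^sup>* a b" if "a \<in> W" "b \<in> W" for a b
  proof -
    have "(\<lambda>a b. {a, b} \<in> induced_edges E W)\<^sup>*\<^sup>* a b"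
      using tree that by (auto simp: is_tree_def connected_graph_def)
    then show ?thesis
      by (rule rtranclp_mono[THEN predicate2D, rotated]) (auto simp: induced_edges_def)
  qed
  moreover have "?R u s" "?R s u"
    using u by (auto simp: induced_edges_def insert_commute)
  ultimately have "?R\<^sup>*\<^sup>* a u \<and> ?R\<^sup>*\<^sup>* u a" if "a \<in> insert s W" for a
    using that u(1) by auto
  then have "connected_graph (insert s W) ?F"
    by (auto simp: connected_graph_def intro: rtranclp_trans)
  moreover have False if p: "is_cycle ?F p" for p
  proof -
    have "e \<subseteq> insert s W" if "e \<in> cycle_edges p" for e
      using p that by (auto simp: is_cycle_def induced_edges_def)
    moreover have "x \<in> \<Union> (cycle_edges p)" if "x \<in> set p" for x
      using that by (auto simp: cycle_edges_def in_set_conv_nth)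
    ultimately have "set p \<subseteq> insert s W"
      by blast
    show False
    proof (cases "s \<in> set p")
      case True
      obtain a b where ab: "a \<noteq> b" "a \<noteq> s" "b \<noteq> s" "{s, a} \<in> ?F" "{s, b} \<in> ?F"
        by (rule is_cycle_two_neighbours[OF p True])
      then have "a \<in> {w \<in> W. {w, s} \<in> E}" "b \<in> {w \<in> W. {w, s} \<in> E}"
        by (auto simp: induced_edges_def insert_commute)
      then show False
        using nbr ab(1) by auto
    next
      case False
      then have "is_cycle (induced_edges E W) p"
        using p \<open>set p \<subseteq> insert s W\<close> cycle_edges_subset[of _ p]
        by (fastforce simp: is_cycle_def induced_edges_def)
      then show False
        using tree by (auto simp: is_tree_def acyclic_graph_def)
    qed
  qed
  ultimately show ?thesis
    by (auto simp: is_tree_def acyclic_graph_def)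
qed

text \<open>Three vertices of a clique form a triangle. This bound is used both for the clique
  inequalities of tree vectors and to cut off inclusion-exclusion in the decomposition.\<close>

lemma is_tree_clique_card_le:
  assumes "is_tree W (induced_edges E W)" "K \<subseteq> W" "clique K E"
  shows "card K \<le> 2"
proof (rule ccontr)
  assume "\<not> card K \<le> 2"
  then obtain L where "L \<subseteq> K" "card L = 3"
    by (metis nat_le_linear not_less_eq_eq numeral_2_eq_2 numeral_3_eq_3 obtain_subset_with_card_n)
  then obtain a b c where abc: "a \<in> K" "b \<in> K" "c \<in> K" "a \<noteq> b" "b \<noteq> c" "a \<noteq> c"
    by (auto simp: card_3_iff)
  then have "is_cycle (induced_edges E W) [a, b, c]"
    using assms(2,3) by (auto simp: is_cycle_def cycle_edges_Cons induced_edges_def clique_def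
        less_Suc_eq nth_Cons')
  then show False
    using assms(1) by (auto simp: is_tree_def acyclic_graph_def)
qed

lemma rtranclp_crossing:
  assumes "R\<^sup>*\<^sup>* a b" "a \<in> A" "b \<notin> A"
  obtains x y where "R x y" "x \<in> A" "y \<notin> A"
  using assms by (induction rule: rtranclp_induct) auto

text \<open>The tree is grown from one vertex along edges leaving the current set. Each new vertex
  brings exactly one edge: a second neighbour would be joined to the first by a path inside the set,
  and the new vertex would close that path to a cycle.\<close>

lemma is_tree_card:
  assumes E2: "\<And>e. e \<in> E \<Longrightarrow> card e = 2"
    and tree: "is_tree W (induced_edges E W)" and "finite W"
  shows "card W = card (induced_edges E W) + 1"
proof -
  have "W \<noteq> {}"
    using tree by (auto simp: is_tree_def connected_graph_def)
  \<comment> \<open>Stage \<open>k\<close> has \<open>k + 1\<close> vertices and \<open>k\<close>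
    edges, so stage \<open>card W - 1\<close> is all of \<open>W\<close>.\<close>
  have "\<exists>A\<subseteq>W. card A = Suc k \<and> connected_graph A (induced_edges E A) \<and>
      card (induced_edges E A) = k" if "k < card W" for k
    using that
  proof (induction k)
    case 0
    obtain s where "s \<in> W"
      using \<open>W \<noteq> {}\<close> by blast
    moreover have "induced_edges E {s} = {}"
      using E2 by (fastforce simp: induced_edges_def subset_singleton_iff)
    ultimately show ?case
      by (intro exI[of _ "{s}"]) (auto simp: connected_graph_def)
  next
    case (Suc k)
    then obtain A where A: "A \<subseteq> W" "card A = Suc k" "connected_graph A (induced_edges E A)"
      "card (induced_edges E A) = k"
      by auto
    have "A \<noteq> {}" "A \<noteq> W"
      using A(2) Suc.prems by auto
    then obtain a b where "a \<in> A" "b \<in> W" "b \<notin> A"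
      using A(1) by blast
    then have "(\<lambda>a b. {a, b} \<in> induced_edges E W)\<^sup>*\<^sup>* a b"
      using A(1) tree by (auto simp: is_tree_def connected_graph_def)
    then obtain x w where xw: "{x, w} \<in> induced_edges E W" "x \<in> A" "w \<notin> A"
      using \<open>a \<in> A\<close> \<open>b \<notin> A\<close> by (rule rtranclp_crossing)
    let ?R = "\<lambda>a b. {a, b} \<in> induced_edges E A"
    have only: "y = x" if y: "y \<in> A" "{y, w} \<in> E" for y
    proof (rule ccontr)
      assume "y \<noteq> x"
      have "?R\<^sup>*\<^sup>* x y"
        using A(3) xw(2) y(1) by (auto simp: connected_graph_def)
      then obtain p where p: "p \<noteq> []" "hd p = x" "last p = y" "successively ?R p" "distinct p"
        using rtranclp_imp_induced_path by meson
      have "set p \<subseteq> A"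
      proof
        fix z
        assume "z \<in> set p"
        then obtain i where i: "i < length p" "z = p ! i"
          by (auto simp: in_set_conv_nth)
        show "z \<in> A"
        proof (cases i)
          case 0
          then show ?thesis
            using i p xw by (simp add: hd_conv_nth)
        next
          case (Suc j)
          then show ?thesis
            using successively_nthD[OF p(4), of j] i by (auto simp: induced_edges_def)
        qed
      qed
      have "is_cycle (induced_edges E W) (w # p)"
      proof (rule is_cycle_path_Cons)
        show "successively (\<lambda>a b. {a, b} \<in> induced_edges E W) p"
          by (rule successively_mono[OF p(4)]) (use A(1) in \<open>auto simp: induced_edges_def\<close>)
        show "{w, hd p} \<in> induced_edges E W" "{w, last p} \<in> induced_edges E W"
          using p xw y A(1) by (auto simp: induced_edges_def insert_commute)
      qed (use p \<open>set p \<subseteq> A\<close> xw \<open>y \<noteq> x\<close> in auto)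
      then show False
        using tree by (auto simp: is_tree_def acyclic_graph_def)
    qed
    have "{x, w} \<in> E"
      using xw by (simp add: induced_edges_def)
    then have nbr: "{z \<in> A. {z, w} \<in> E} = {x}"
      using only xw(2) by blast
    have "e = {x, w}" if e: "e \<in> E" "e \<subseteq> insert w A" "w \<in> e" for e
    proof -
      obtain z where "e = {z, w}" "z \<noteq> w"
        using E2[OF e(1)] e(3) by (auto simp: card_2_iff)
      then show ?thesis
        using nbr e by auto
    qed
    then have "induced_edges E (insert w A) = insert {x, w} (induced_edges E A)"
      using xw by (auto simp: induced_edges_def)
    moreover have "finite A"
      using A(1) \<open>finite W\<close> finite_subset by blast
    then have "finite (induced_edges E A)"
      by (rule finite_induced_edges)
    moreover have "{x, w} \<notin> induced_edges E A"
      using xw by (auto simp: induced_edges_def)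
    ultimately have edges: "card (induced_edges E (insert w A)) = Suc k"
      using A(4) by simp
    let ?R' = "\<lambda>a b. {a, b} \<in> induced_edges E (insert w A)"
    have "?R'\<^sup>*\<^sup>* c d" if "c \<in> A" "d \<in> A" for c d
    proof -
      have "?R\<^sup>*\<^sup>* c d"
        using A(3) that by (auto simp: connected_graph_def)
      then show ?thesis
        by (rule rtranclp_mono[THEN predicate2D, rotated]) (auto simp: induced_edges_def)
    qed
    moreover have "?R' x w" "?R' w x"
      using xw by (auto simp: induced_edges_def insert_commute)
    ultimately have "?R'\<^sup>*\<^sup>* c x \<and> ?R'\<^sup>*\<^sup>* x c" if "c \<in> insert w A" for c
      using that xw(2) by auto
    then have "connected_graph (insert w A) (induced_edges E (insert w A))"
      by (auto simp: connected_graph_def intro: rtranclp_trans)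
    then show ?case
      using edges A xw \<open>finite A\<close>
      by (intro exI[of _ "insert w A"]) (auto simp: induced_edges_def)
  qed
  from this[of "card W - 1"] obtain A where "A \<subseteq> W" "card A = card W"
    "card (induced_edges E A) = card W - 1"
    using \<open>W \<noteq> {}\<close> \<open>finite W\<close> by (auto simp: card_gt_0_iff)
  moreover from this have "A = W"
    using \<open>finite W\<close> card_subset_eq by blast
  ultimately show ?thesis
    using \<open>W \<noteq> {}\<close> \<open>finite W\<close> by (simp add: card_gt_0_iff Suc_leI)
qed

section \<open>Tree decompositions\<close>

text \<open>A conic decomposition: nothing is said about the total weight. The weights live on all
  sets and vanish off the trees, so that the sums range over \<open>Pow U\<close>, which splits
  evenly when a vertex is added to \<open>U\<close>.\<close>

definition tree_weights ::
    "'v set set \<Rightarrow> 'v set \<Rightarrow> ('v \<Rightarrow> real) \<Rightarrow> ('v set \<Rightarrow> real) \<Rightarrow> ('v set \<Rightarrow> real) \<Rightarrow> bool" where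
  "tree_weights E U x y l \<longleftrightarrow>
    (\<forall>W. 0 \<le> l W) \<and>
    (\<forall>W. l W \<noteq> 0 \<longrightarrow> W \<subseteq> U \<and> is_tree W (induced_edges E W)) \<and>
    (\<forall>v\<in>U. (\<Sum>W\<in>Pow U. l W * of_bool (v \<in> W)) = x v) \<and>
    (\<forall>e\<in>E. e \<subseteq> U \<longrightarrow> (\<Sum>W\<in>Pow U. l W * of_bool (e \<subseteq> W)) = y e)"

text \<open>If \<open>s\<close> is simplicial with neighbourhood \<open>N\<close>, a tree meets the clique \<open>N\<close> in at most two
  vertices, so the trees meeting \<open>N\<close> exactly in \<open>u\<close> have total weight
  \<open>D u = x u - (\<Sum>w\<in>N - {u}. y {w, u})\<close>. By the inequality for \<open>u\<close> and \<open>N \<union> {s}\<close> this is at least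
  \<open>y {u, s}\<close>, so \<open>s\<close> can be attached to a fraction \<open>t\<close> of each of them.\<close>

lemma chordal_tree_decomposition:
  fixes x :: "'v \<Rightarrow> real" and y :: "'v set \<Rightarrow> real"
  assumes E2: "\<And>e. e \<in> E \<Longrightarrow> card e = 2" and "chordal E" and "finite U"
    and "\<And>e. 0 \<le> y e"
    and "\<And>K v. K \<subseteq> U \<Longrightarrow> clique K E \<Longrightarrow> v \<in> K \<Longrightarrow> (\<Sum>u\<in>K - {v}. y {u, v}) \<le> x v"
  shows "\<exists>l. tree_weights E U x y l"
  using assms(3,5)
proof (induction U rule: finite_psubset_induct)
  case (psubset U)
  note y0 = assms(4) and cl = psubset.prems
  show ?case
  proof (cases "U = {}")
    case True
    have "e \<noteq> {}" if "e \<in> E" for e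
      using E2[OF that] by auto
    then show ?thesis
      using True by (intro exI[of _ "\<lambda>_. 0"]) (auto simp: tree_weights_def)
  next
    case False
    obtain s where s: "s \<in> U" "clique {u \<in> U. {u, s} \<in> E} E"
      using chordal_simplicial_exists[OF E2 \<open>chordal E\<close> \<open>finite U\<close> False] by blast
    define N where "N = {u \<in> U. {u, s} \<in> E}"
    define U' where "U' = U - {s}"
    have N: "N \<subseteq> U'" "clique N E" "clique (insert s N) E" "finite N"
      using s \<open>finite U\<close> card2_no_loop[OF E2, where a = s]
      by (auto simp: N_def U'_def clique_def insert_commute)
    have U': "U = insert s U'" "s \<notin> U'" "finite U'" "U' \<subset> U"
      using s \<open>finite U\<close> by (auto simp: U'_def)
    have "\<exists>l. tree_weights E U' x y l"
      by (rule psubset.IH[OF U'(4)]) (use cl U'(1) in blast)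
    then obtain l where l: "tree_weights E U' x y l" ..
    then have l0: "\<And>W. 0 \<le> l W"
      and ltree: "\<And>W. l W \<noteq> 0 \<Longrightarrow> W \<subseteq> U' \<and> is_tree W (induced_edges E W)"
      and lv: "\<And>v. v \<in> U' \<Longrightarrow> (\<Sum>W\<in>Pow U'. l W * of_bool (v \<in> W)) = x v"
      and le: "\<And>e. e \<in> E \<Longrightarrow> e \<subseteq> U' \<Longrightarrow> (\<Sum>W\<in>Pow U'. l W * of_bool (e \<subseteq> W)) = y e"
      unfolding tree_weights_def by simp_all
    define D where "D u = (\<Sum>W\<in>Pow U'. l W * of_bool (W \<inter> N = {u}))" for u
    have D_ge: "y {u, s} \<le> D u" if u: "u \<in> N" for u
    proof -
      \<comment> \<open>A tree through \<open>u\<close> has at most one further vertex in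
        \<open>N\<close>, so one minus the number of such vertices is the indicator of having
        none.\<close>
      have "l W * of_bool (W \<inter> N = {u}) =
          l W * of_bool (u \<in> W) - (\<Sum>w\<in>N - {u}. l W * of_bool ({w, u} \<subseteq> W))" for W
      proof (cases "l W = 0 \<or> u \<notin> W")
        case True
        then show ?thesis
          by auto
      next
        case False
        then have "is_tree W (induced_edges E W)" "u \<in> W"
          using ltree by auto
        moreover have "clique (W \<inter> N) E"
          using N(2) by (rule smaller_clique) blast
        ultimately have "card (W \<inter> N) \<le> 2"
          using is_tree_clique_card_le by blast
        then have le1: "card (W \<inter> N - {u}) \<le> 1"
          using \<open>u \<in> W\<close> u N(4) by simp
        have "card (W \<inter> N - {u}) = 0 \<longleftrightarrow> W \<inter> N - {u} = {}"
          using N(4) by (intro card_0_eq) blast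
        then have iff: "W \<inter> N = {u} \<longleftrightarrow> card (W \<inter> N - {u}) = 0"
          using \<open>u \<in> W\<close> u by blast
        have "(N - {u}) \<inter> {w. {w, u} \<subseteq> W} = W \<inter> N - {u}"
          using \<open>u \<in> W\<close> by auto
        then have "(\<Sum>w\<in>N - {u}. of_bool ({w, u} \<subseteq> W)) = real (card (W \<inter> N - {u}))"
          using N(4) by (simp only: sum_of_bool_eq finite_Diff)
        moreover have "of_bool (W \<inter> N = {u}) = 1 - real (card (W \<inter> N - {u}))"
          unfolding iff using le1 by (cases "card (W \<inter> N - {u}) = 0") auto
        ultimately show ?thesis
          using \<open>u \<in> W\<close> by (simp add: sum_distrib_left[symmetric] right_diff_distrib)
      qed
      then have "D u = (\<Sum>W\<in>Pow U'. l W * of_bool (u \<in> W)) -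
          (\<Sum>W\<in>Pow U'. \<Sum>w\<in>N - {u}. l W * of_bool ({w, u} \<subseteq> W))"
        unfolding D_def by (simp only: sum_subtractf)
      also have "(\<Sum>W\<in>Pow U'. \<Sum>w\<in>N - {u}. l W * of_bool ({w, u} \<subseteq> W)) =
          (\<Sum>w\<in>N - {u}. \<Sum>W\<in>Pow U'. l W * of_bool ({w, u} \<subseteq> W))"
        by (rule sum.swap)
      also have "\<dots> = (\<Sum>w\<in>N - {u}. y {w, u})"
        using N(1,2) u by (intro sum.cong refl le) (auto simp: clique_def)
      also have "(\<Sum>W\<in>Pow U'. l W * of_bool (u \<in> W)) = x u"
        using lv N(1) u by blast
      finally have D: "D u = x u - (\<Sum>w\<in>N - {u}. y {w, u})" .
      have "(\<Sum>w\<in>insert s N - {u}. y {w, u}) \<le> x u"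
        using cl[of "insert s N" u] N U'(1) u by blast
      moreover have "insert s N - {u} = insert s (N - {u})" "s \<notin> N - {u}"
        using u N(1) U'(2) by auto
      ultimately show ?thesis
        using D N(4) by (simp add: insert_commute)
    qed
    \<comment> \<open>This fraction spends exactly \<open>y {u, s}\<close> of the weight
      \<open>D u\<close>. If \<open>D u = 0\<close>, then \<open>D_ge\<close> forces
      \<open>y {u, s} = 0\<close>, and division by zero returns the right value 0. Trees meeting
      \<open>N\<close> in no vertex or in several are left alone: \<open>s\<close> would not be a
      leaf there.\<close>
    define t where "t W = (if \<exists>u. W \<inter> N = {u} then y {the_elem (W \<inter> N), s} / D (the_elem (W \<inter> N)) else 0)"
      for W
    have t_eq: "t W = y {u, s} / D u" if "W \<inter> N = {u}" for W u
      using that by (simp add: t_def)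
    have t_single: "\<exists>u\<in>N. W \<inter> N = {u}" if "t W \<noteq> 0" for W
      using that by (auto simp: t_def split: if_splits)
    have t01: "0 \<le> t W" "t W \<le> 1" for W
    proof -
      have "0 \<le> t W \<and> t W \<le> 1"
      proof (cases "t W = 0")
        case False
        then obtain u where "u \<in> N" "W \<inter> N = {u}"
          using t_single by blast
        then show ?thesis
          using y0[of "{u, s}"] D_ge[of u] by (auto simp: t_eq divide_le_eq_1)
      qed simp
      then show "0 \<le> t W" "t W \<le> 1"
        by auto
    qed
    have attached: "(\<Sum>W\<in>Pow U'. l W * t W * of_bool (u \<in> W)) = y {u, s}" if u: "u \<in> N" for u
    proof -
      have "l W * t W * of_bool (u \<in> W) = l W * of_bool (W \<inter> N = {u}) * (y {u, s} / D u)" for W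
      proof (cases "W \<inter> N = {u}")
        case True
        then show ?thesis
          by (auto simp: t_eq)
      next
        case False
        then have "t W = 0 \<or> u \<notin> W"
          using t_single[of W] u by (metis IntI singletonD)
        then show ?thesis
          using False by auto
      qed
      then have "(\<Sum>W\<in>Pow U'. l W * t W * of_bool (u \<in> W)) = D u * (y {u, s} / D u)"
        unfolding D_def by (simp only: sum_distrib_right)
      then show ?thesis
        using y0[of "{u, s}"] D_ge[OF u] by auto
    qed
    have total: "(\<Sum>W\<in>Pow U'. l W * t W) = (\<Sum>u\<in>N. y {u, s})"
    proof -
      \<comment> \<open>A set with nonzero \<open>t\<close> meets \<open>N\<close> in a single
        vertex and is therefore counted once.\<close>
      have "l W * t W = (\<Sum>u\<in>N. l W * t W * of_bool (u \<in> W))" for W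
      proof (cases "t W = 0")
        case False
        then obtain u where u: "u \<in> N" "W \<inter> N = {u}"
          using t_single by blast
        then have "(\<Sum>v\<in>N. l W * t W * of_bool (v \<in> W)) = (\<Sum>v\<in>N. if v = u then l W * t W else 0)"
          by (intro sum.cong) auto
        then show ?thesis
          using u N(4) by simp
      qed simp
      then have "(\<Sum>W\<in>Pow U'. l W * t W) = (\<Sum>W\<in>Pow U'. \<Sum>u\<in>N. l W * t W * of_bool (u \<in> W))"
        by (rule sum.cong[OF refl])
      also have "\<dots> = (\<Sum>u\<in>N. \<Sum>W\<in>Pow U'. l W * t W * of_bool (u \<in> W))"
        by (rule sum.swap)
      finally show ?thesis
        by (simp add: attached)
    qed
    define r where "r = x s - (\<Sum>u\<in>N. y {u, s})"
    have "s \<notin> N"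
      using N(1) U'(2) by blast
    have "0 \<le> r"
      using cl[of "insert s N" s] N U'(1) \<open>s \<notin> N\<close> by (auto simp: r_def)
    \<comment> \<open>Each old tree is split into the part \<open>1 - t\<close> that stays and the
      part \<open>t\<close> that receives the leaf \<open>s\<close>.\<close>
    define m where "m W = (if s \<in> W then l (W - {s}) * t (W - {s}) + of_bool (W = {s}) * r
        else l W * (1 - t W))" for W
    have m_sum: "(\<Sum>W\<in>Pow U. m W * g W) =
        (\<Sum>W\<in>Pow U'. l W * (1 - t W) * g W) + (\<Sum>W\<in>Pow U'. l W * t W * g (insert s W)) + r * g {s}"
      for g
    proof -
      have "inj_on (insert s) (Pow U')"
        using U'(2) by (auto simp: inj_on_def)
      moreover have "Pow U' \<inter> insert s ` Pow U' = {}"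
        using U'(2) by auto
      ultimately have "(\<Sum>W\<in>Pow U. m W * g W) =
          (\<Sum>W\<in>Pow U'. m W * g W) + (\<Sum>W\<in>Pow U'. m (insert s W) * g (insert s W))"
        using U'(3) by (simp add: U'(1) Pow_insert sum.union_disjoint sum.reindex)
      also have "(\<Sum>W\<in>Pow U'. m W * g W) = (\<Sum>W\<in>Pow U'. l W * (1 - t W) * g W)"
        using U'(2) by (intro sum.cong) (auto simp: m_def)
      also have "(\<Sum>W\<in>Pow U'. m (insert s W) * g (insert s W)) =
          (\<Sum>W\<in>Pow U'. l W * t W * g (insert s W) + (if W = {} then r * g {s} else 0))"
      proof (intro sum.cong refl)
        fix W
        assume "W \<in> Pow U'"
        then have "s \<notin> W"
          using U'(2) by auto
        then have "insert s W - {s} = W" "insert s W = {s} \<longleftrightarrow> W = {}"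
          by auto
        then show "m (insert s W) * g (insert s W) =
            l W * t W * g (insert s W) + (if W = {} then r * g {s} else 0)"
          by (simp add: m_def distrib_right)
      qed
      also have "\<dots> = (\<Sum>W\<in>Pow U'. l W * t W * g (insert s W)) + r * g {s}"
        using U'(3) by (simp add: sum.distrib)
      finally show ?thesis
        by simp
    qed
    \<comment> \<open>For coordinates that do not involve \<open>s\<close> the two parts of each
      tree recombine. The condition on the empty set removes the contribution of \<open>{s}\<close>;
      it holds for an edge because edges are nonempty.\<close>
    have m_sum_eq: "(\<Sum>W\<in>Pow U. m W * g W) = (\<Sum>W\<in>Pow U'. l W * g W)"
      if "\<And>W. g (insert s W) = g W" "g {} = 0" for g
      unfolding m_sum that by (simp add: sum.distrib[symmetric] distrib_right[symmetric]
          distrib_left[symmetric])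
    have "0 \<le> m W" for W
      using l0 t01 \<open>0 \<le> r\<close> by (simp add: m_def)
    moreover have "W \<subseteq> U \<and> is_tree W (induced_edges E W)" if "m W \<noteq> 0" for W
    proof (cases "s \<in> W")
      case False
      then show ?thesis
        using that ltree[of W] U'(1) by (auto simp: m_def)
    next
      case True
      show ?thesis
      proof (cases "W = {s}")
        case True
        then show ?thesis
          using is_tree_singleton[OF E2] s by auto
      next
        case False
        define W' where "W' = W - {s}"
        have W': "W = insert s W'" "s \<notin> W'"
          using \<open>s \<in> W\<close> by (auto simp: W'_def)
        have nz: "l W' \<noteq> 0" "t W' \<noteq> 0"
          using that True False by (auto simp: m_def W'_def)
        have sub: "W' \<subseteq> U'" "is_tree W' (induced_edges E W')"
          using ltree[OF nz(1)] by auto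
        obtain u where "W' \<inter> N = {u}"
          using t_single[OF nz(2)] by blast
        moreover have "{w \<in> W'. {w, s} \<in> E} = W' \<inter> N"
          using sub(1) U'(1) by (auto simp: N_def)
        ultimately show ?thesis
          using is_tree_insert_leaf[OF sub(2) W'(2)] sub(1) U'(1) W'(1) by auto
      qed
    qed
    moreover have "(\<Sum>W\<in>Pow U. m W * of_bool (v \<in> W)) = x v" if "v \<in> U" for v
    proof (cases "v = s")
      case True
      have "(\<Sum>W\<in>Pow U'. l W * (1 - t W) * of_bool (s \<in> W)) = 0"
        using U'(2) by (intro sum.neutral) auto
      then show ?thesis
        using True by (simp add: m_sum total r_def)
    next
      case False
      then have "v \<in> U'"
        using that U'(1) by blast
      then show ?thesis
        using False by (subst m_sum_eq) (auto simp: lv)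
    qed
    moreover have "(\<Sum>W\<in>Pow U. m W * of_bool (e \<subseteq> W)) = y e" if e: "e \<in> E" "e \<subseteq> U" for e
    proof (cases "s \<in> e")
      case True
      obtain u where u: "e = {u, s}" "u \<noteq> s"
        using E2[OF e(1)] True by (auto simp: card_2_iff)
      then have "u \<in> N"
        using e by (auto simp: N_def)
      have "(\<Sum>W\<in>Pow U'. l W * (1 - t W) * of_bool (e \<subseteq> W)) = 0"
        using U'(2) u by (intro sum.neutral) auto
      moreover have "(\<Sum>W\<in>Pow U'. l W * t W * of_bool (e \<subseteq> insert s W)) = y e"
        using attached[OF \<open>u \<in> N\<close>] u by simp
      ultimately show ?thesis
        using u by (simp add: m_sum)
    next
      case False
      then have "e \<subseteq> U'"
        using e U'(1) by auto
      moreover have "e \<noteq> {}"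
        using E2[OF e(1)] by auto
      ultimately show ?thesis
        using False e(1) by (subst m_sum_eq) (auto simp: le subset_insert)
    qed
    ultimately have "tree_weights E U x y m"
      unfolding tree_weights_def by simp
    then show ?thesis
      by (intro exI[of _ m])
  qed
qed

section \<open>The polyhedra\<close>

lemma simple_graphD:
  assumes "simple_graph V E"
  shows "finite V" "finite E" "\<And>e. e \<in> E \<Longrightarrow> card e = 2" "\<And>e. e \<in> E \<Longrightarrow> e \<subseteq> V"
proof -
  show "finite V" "\<And>e. e \<in> E \<Longrightarrow> card e = 2" "\<And>e. e \<in> E \<Longrightarrow> e \<subseteq> V"
    using assms by (auto simp: simple_graph_def nsets_def)
  then show "finite E"
    by (metis PowI finite_Pow_iff finite_subset subsetI)
qed

section \<open>The cone and its affine slice in coordinates\<close>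

lemma lookup_scaleR_poly_mapping [simp]:
  fixes x :: "'a \<Rightarrow>\<^sub>0 'b::real_vector"
  shows "Poly_Mapping.lookup (r *\<^sub>R x) i = r *\<^sub>R Poly_Mapping.lookup x i"
proof -
  have "finite {i. r *\<^sub>R Poly_Mapping.lookup x i \<noteq> 0}"
    by (rule finite_subset[OF _ finite_keys[of x]]) (auto simp: in_keys_iff)
  then show ?thesis
    by (simp add: scaleR_poly_mapping_def Abs_poly_mapping_inverse)
qed

lemma ve_space_iff:
  "z \<in> ve_space V E \<longleftrightarrow> (\<forall>v. v \<notin> V \<longrightarrow> Poly_Mapping.lookup (fst z) v = 0) \<and>
    (\<forall>e. e \<notin> E \<longrightarrow> Poly_Mapping.lookup (snd z) e = 0)"
  by (cases z) (auto simp: ve_space_def in_keys_iff subset_iff)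

text \<open>On an incidence vector this is the Euler characteristic of the induced subgraph: 1 for a
  tree, 0 for a cycle.\<close>

definition euler_functional :: "'v set \<Rightarrow> 'v set set \<Rightarrow> 'v ve_vec \<Rightarrow> real" where
  "euler_functional V E z =
    (\<Sum>v\<in>V. Poly_Mapping.lookup (fst z) v) - (\<Sum>e\<in>E. Poly_Mapping.lookup (snd z) e)"

lemma poly_T_iff: "z \<in> poly_T V E \<longleftrightarrow> z \<in> cone_T V E \<and> euler_functional V E z = 1"
  by (auto simp: poly_T_def euler_functional_def)

lemma cone_T_iff:
  "z \<in> cone_T V E \<longleftrightarrow> z \<in> ve_space V E \<and>
    (\<forall>v\<in>V. \<forall>K\<in>maximal_cliques_at V E v.
      (\<Sum>u\<in>K - {v}. Poly_Mapping.lookup (snd z) {u, v}) \<le> Poly_Mapping.lookup (fst z) v) \<and>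
    (\<forall>v\<in>V. 0 \<le> Poly_Mapping.lookup (fst z) v) \<and> (\<forall>e\<in>E. 0 \<le> Poly_Mapping.lookup (snd z) e)"
  by (cases z) (simp add: cone_T_def)

lemma euler_functional_add:
  "euler_functional V E (z + w) = euler_functional V E z + euler_functional V E w"
  by (simp add: euler_functional_def lookup_add sum.distrib)

lemma euler_functional_scaleR: "euler_functional V E (c *\<^sub>R z) = c * euler_functional V E z"
  by (simp add: euler_functional_def sum_distrib_left right_diff_distrib)

lemma cone_T_add:
  assumes "z \<in> cone_T V E" "w \<in> cone_T V E"
  shows "z + w \<in> cone_T V E"
  using assms by (auto simp: cone_T_iff ve_space_iff lookup_add sum.distrib intro!: add_mono)

lemma cone_T_scaleR:
  assumes "z \<in> cone_T V E" "0 \<le> c"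
  shows "c *\<^sub>R z \<in> cone_T V E"
  using assms by (auto simp: cone_T_iff ve_space_iff sum_distrib_left[symmetric] intro!: mult_left_mono)

lemma convex_poly_T: "convex (poly_T V E)"
  by (rule convexI)
    (simp add: poly_T_iff cone_T_add cone_T_scaleR euler_functional_add euler_functional_scaleR)

section \<open>Clique inequalities and incidence vectors\<close>

lemma clique_subset_maximal_clique:
  assumes "finite V" "K \<subseteq> V" "clique K E"
  obtains K' where "K' \<in> maximal_cliques V E" "K \<subseteq> K'"
proof -
  let ?A = "{K. K \<subseteq> V \<and> clique K E}"
  have "finite ?A" "K \<in> ?A"
    using assms by auto
  from finite_has_maximal2[OF this] obtain K'
    where K': "K' \<in> ?A" "K \<subseteq> K'" "\<forall>L\<in>?A. K' \<subseteq> L \<longrightarrow> K' = L"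
    by blast
  then have "K' \<in> maximal_cliques V E"
    unfolding maximal_cliques_def by blast
  then show ?thesis
    using K'(2) by (rule that)
qed

text \<open>Enlarging \<open>K\<close> to a maximal clique only adds nonnegative terms on the
  left.\<close>

lemma cone_T_clique_inequality:
  assumes "finite V" "z \<in> cone_T V E" "K \<subseteq> V" "clique K E" "v \<in> K"
  shows "(\<Sum>u\<in>K - {v}. Poly_Mapping.lookup (snd z) {u, v}) \<le> Poly_Mapping.lookup (fst z) v"
proof -
  obtain K' where K': "K' \<in> maximal_cliques V E" "K \<subseteq> K'"
    using clique_subset_maximal_clique[OF assms(1,3,4)] .
  have nonneg: "0 \<le> Poly_Mapping.lookup (snd z) e" for e
    using assms(2) by (cases "e \<in> E") (auto simp: cone_T_iff ve_space_iff)
  have "finite K'"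
    using K'(1) assms(1) by (auto simp: maximal_cliques_def intro: finite_subset)
  then have "(\<Sum>u\<in>K - {v}. Poly_Mapping.lookup (snd z) {u, v}) \<le>
      (\<Sum>u\<in>K' - {v}. Poly_Mapping.lookup (snd z) {u, v})"
    using K'(2) nonneg by (intro sum_mono2) auto
  also have "\<dots> \<le> Poly_Mapping.lookup (fst z) v"
    using assms(2,3,5) K' by (auto simp: cone_T_iff maximal_cliques_at_def)
  finally show ?thesis .
qed

lemma lookup_ext_incidence:
  assumes "finite W"
  shows "Poly_Mapping.lookup (fst (ext_incidence E W)) v = of_bool (v \<in> W)"
    and "Poly_Mapping.lookup (snd (ext_incidence E W)) e = of_bool (e \<in> E \<and> e \<subseteq> W)"
  using assms finite_induced_edges[OF assms, of E]
  by (auto simp: ext_incidence_def lookup_ind_vec induced_edges_def)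

lemma euler_functional_ext_incidence:
  assumes "simple_graph V E" "W \<subseteq> V"
  shows "euler_functional V E (ext_incidence E W) = real (card W) - real (card (induced_edges E W))"
proof -
  have "finite W"
    using assms simple_graphD(1) finite_subset by metis
  moreover have "V \<inter> {v. v \<in> W} = W" "E \<inter> {e. e \<in> E \<and> e \<subseteq> W} = induced_edges E W"
    using assms(2) by (auto simp: induced_edges_def)
  ultimately show ?thesis
    using simple_graphD(1,2)[OF assms(1)]
    by (simp only: euler_functional_def lookup_ext_incidence sum_of_bool_eq)
qed

text \<open>Stated for triangle-free sets so that it serves trees and holes alike. A clique through
  a vertex \<open>v\<close> of \<open>W\<close> meets \<open>W\<close> in at most one other vertex,
  so the left side is at most 1; for \<open>v\<close> outside \<open>W\<close> it is 0.\<close>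

lemma ext_incidence_in_cone_T:
  assumes "simple_graph V E" "W \<subseteq> V"
    and no_triangle: "\<And>K. K \<subseteq> W \<Longrightarrow> clique K E \<Longrightarrow> card K \<le> 2"
  shows "ext_incidence E W \<in> cone_T V E"
proof -
  have "finite W"
    using assms simple_graphD(1) finite_subset by metis
  have "(\<Sum>u\<in>K - {v}. of_bool ({u, v} \<in> E \<and> {u, v} \<subseteq> W)) \<le> (of_bool (v \<in> W) :: real)"
    if K: "K \<in> maximal_cliques_at V E v" for v K
  proof (cases "v \<in> W")
    case True
    have "K \<subseteq> V" "clique K E" "v \<in> K"
      using K by (auto simp: maximal_cliques_at_def maximal_cliques_def)
    then have "finite K"
      using simple_graphD(1)[OF assms(1)] finite_subset by blast
    have "clique (K \<inter> W) E"
      using \<open>clique K E\<close> by (rule smaller_clique) blast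
    then have "card (K \<inter> W) \<le> 2"
      using no_triangle by blast
    then have "card (K \<inter> W - {v}) \<le> 1"
      using True \<open>v \<in> K\<close> \<open>finite K\<close> by simp
    moreover have "card ((K - {v}) \<inter> {u. {u, v} \<in> E \<and> {u, v} \<subseteq> W}) \<le> card (K \<inter> W - {v})"
      using \<open>finite K\<close> by (intro card_mono) auto
    ultimately show ?thesis
      using True \<open>finite K\<close> by (simp only: sum_of_bool_eq finite_Diff) simp
  qed simp
  then show ?thesis
    using assms(2) \<open>finite W\<close> by (auto simp: cone_T_iff ve_space_iff lookup_ext_incidence)
qed

lemma induced_tree_in_poly_T:
  assumes "simple_graph V E" "induced_tree V E W"
  shows "ext_incidence E W \<in> poly_T V E"
proof -
  have W: "W \<subseteq> V" "is_tree W (induced_edges E W)"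
    using assms(2) by (auto simp: induced_tree_def)
  then have "finite W"
    using assms simple_graphD(1) finite_subset by metis
  then have "card W = card (induced_edges E W) + 1"
    using is_tree_card[OF simple_graphD(3)[OF assms(1)] W(2)] by simp
  then have "euler_functional V E (ext_incidence E W) = 1"
    using euler_functional_ext_incidence[OF assms(1) W(1)] by simp
  moreover have "ext_incidence E W \<in> cone_T V E"
    using ext_incidence_in_cone_T[OF assms(1) W(1) is_tree_clique_card_le[OF W(2)]] .
  ultimately show ?thesis
    by (simp add: poly_T_iff)
qed

section \<open>Comparison of the two polyhedra\<close>

lemma induced_tree_polytope_subset_poly_T:
  "simple_graph V E \<Longrightarrow> induced_tree_polytope V E \<subseteq> poly_T V E"
  unfolding induced_tree_polytope_def
  by (intro hull_minimal convex_poly_T) (auto intro: induced_tree_in_poly_T)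

lemma bounded_induced_tree_polytope:
  assumes "simple_graph V E"
  shows "bounded (induced_tree_polytope V E)"
proof -
  have "{ext_incidence E W |W. induced_tree V E W} \<subseteq> ext_incidence E ` Pow V"
    by (auto simp: induced_tree_def)
  then have "finite {ext_incidence E W |W. induced_tree V E W}"
    using simple_graphD(1)[OF assms] finite_subset by blast
  then show ?thesis
    unfolding induced_tree_polytope_def by (intro bounded_convex_hull finite_imp_bounded)
qed

lemma chordal_poly_T_subset:
  assumes "simple_graph V E" "chordal E"
  shows "poly_T V E \<subseteq> induced_tree_polytope V E"
proof
  fix z
  assume z: "z \<in> poly_T V E"
  note graph = simple_graphD[OF assms(1)]
  have cone: "z \<in> cone_T V E"
    using z by (simp add: poly_T_iff)
  have "\<exists>l. tree_weights E V (Poly_Mapping.lookup (fst z)) (Poly_Mapping.lookup (snd z)) l"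
  proof (rule chordal_tree_decomposition[OF graph(3) assms(2) graph(1)])
    show "0 \<le> Poly_Mapping.lookup (snd z) e" for e
      using cone by (cases "e \<in> E") (auto simp: cone_T_iff ve_space_iff)
  qed (use cone_T_clique_inequality[OF graph(1) cone] in auto)
  then obtain l where
    l: "tree_weights E V (Poly_Mapping.lookup (fst z)) (Poly_Mapping.lookup (snd z)) l" ..
  define T where "T = {W. induced_tree V E W}"
  have "T \<subseteq> Pow V"
    by (auto simp: T_def induced_tree_def)
  then have "finite T"
    using graph(1) finite_subset by blast
  have support: "l W = 0" if "W \<notin> T" for W
    using l that by (auto simp: tree_weights_def T_def induced_tree_def)
  have restrict: "(\<Sum>W\<in>Pow V. l W * g W) = (\<Sum>W\<in>T. l W * g W)" for g
    using \<open>T \<subseteq> Pow V\<close> graph(1) support by (intro sum.mono_neutral_right) auto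
  have fin: "finite W" if "W \<in> T" for W
    using that \<open>T \<subseteq> Pow V\<close> graph(1) by (auto intro: finite_subset)
  have z_eq: "z = (\<Sum>W\<in>T. l W *\<^sub>R ext_incidence E W)"
  proof (rule prod_eqI; rule poly_mapping_eqI)
    fix v
    have "Poly_Mapping.lookup (fst (\<Sum>W\<in>T. l W *\<^sub>R ext_incidence E W)) v =
        (\<Sum>W\<in>T. l W * of_bool (v \<in> W))"
      using fin by (simp add: fst_sum lookup_sum lookup_ext_incidence)
    also have "\<dots> = Poly_Mapping.lookup (fst z) v"
    proof (cases "v \<in> V")
      case True
      then show ?thesis
        using l by (simp add: tree_weights_def restrict)
    next
      case False
      then have "v \<notin> W" if "W \<in> T" for W
        using that \<open>T \<subseteq> Pow V\<close> by blast
      then show ?thesis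
        using cone False by (simp add: cone_T_iff ve_space_iff)
    qed
    finally show "Poly_Mapping.lookup (fst z) v =
        Poly_Mapping.lookup (fst (\<Sum>W\<in>T. l W *\<^sub>R ext_incidence E W)) v"
      by simp
  next
    fix e
    have "Poly_Mapping.lookup (snd (\<Sum>W\<in>T. l W *\<^sub>R ext_incidence E W)) e =
        (\<Sum>W\<in>T. l W * of_bool (e \<in> E \<and> e \<subseteq> W))"
      using fin by (simp add: snd_sum lookup_sum lookup_ext_incidence)
    also have "\<dots> = Poly_Mapping.lookup (snd z) e"
    proof (cases "e \<in> E")
      case True
      then show ?thesis
        using l graph(4) by (simp add: tree_weights_def restrict)
    next
      case False
      then show ?thesis
        using cone by (simp add: cone_T_iff ve_space_iff)
    qed
    finally show "Poly_Mapping.lookup (snd z) e =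
        Poly_Mapping.lookup (snd (\<Sum>W\<in>T. l W *\<^sub>R ext_incidence E W)) e"
      by simp
  qed
  \<comment> \<open>The functional is 1 on every tree vector, so on a combination it reads off the
    total weight; evaluating it at \<open>z\<close> gives total weight 1.\<close>
  have "euler_functional V E (\<Sum>W\<in>S. l W *\<^sub>R ext_incidence E W) = sum l S"
    if "finite S" "S \<subseteq> T" for S
    using that
  proof (induction S rule: finite_induct)
    case empty
    then show ?case
      by (simp add: euler_functional_def)
  next
    case (insert W S)
    then have "euler_functional V E (ext_incidence E W) = 1"
      using induced_tree_in_poly_T[OF assms(1)] by (auto simp: T_def poly_T_iff)
    then show ?case
      using insert by (simp add: euler_functional_add euler_functional_scaleR)
  qed
  from this[OF \<open>finite T\<close> subset_refl] have "sum l T = 1"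
    using z z_eq by (simp add: poly_T_iff)
  moreover have "ext_incidence E W \<in> induced_tree_polytope V E" if "W \<in> T" for W
    using that unfolding induced_tree_polytope_def T_def by (auto intro: hull_inc)
  ultimately show "z \<in> induced_tree_polytope V E"
    unfolding z_eq using \<open>finite T\<close> l
    by (intro convex_sum) (auto simp: induced_tree_polytope_def tree_weights_def)
qed

section \<open>Holes as unbounded directions\<close>

lemma hole_clique_card_le:
  assumes "is_hole E p" "K \<subseteq> set p" "clique K E"
  shows "card K \<le> 2"
proof (rule ccontr)
  assume "\<not> card K \<le> 2"
  then obtain L where "L \<subseteq> K" "card L = 3"
    by (metis nat_le_linear not_less_eq_eq numeral_2_eq_2 numeral_3_eq_3 obtain_subset_with_card_n)
  then obtain a b c where abc: "a \<in> K" "b \<in> K" "c \<in> K" "a \<noteq> b" "b \<noteq> c" "a \<noteq> c"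
    by (auto simp: card_3_iff)
  then obtain i j k where ijk: "a = p ! i" "b = p ! j" "c = p ! k"
    "i < length p" "j < length p" "k < length p"
    using assms(2) by (metis in_set_conv_nth subsetD)
  have p: "distinct p" "length p \<ge> 4" "induced_edges E (set p) = cycle_edges p"
    using assms(1) by (auto simp: is_hole_def is_cycle_def)
  have "{a, b} \<in> cycle_edges p" "{b, c} \<in> cycle_edges p" "{a, c} \<in> cycle_edges p"
    using abc assms(2,3) unfolding p(3)[symmetric] by (auto simp: induced_edges_def clique_def)
  \<comment> \<open>Three distinct positions that are pairwise cyclically adjacent exist only in a
    cycle of length 3.\<close>
  then show False
    using p ijk abc by (auto simp: cycle_edge_iff mod_Suc split: if_splits)
qed

lemma bounded_poly_T_imp_chordal:
  assumes "simple_graph V E" "bounded (poly_T V E)"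
  shows "chordal E"
  unfolding chordal_def
proof
  assume "\<exists>p. is_hole E p"
  then obtain p where hole: "is_hole E p" ..
  then have p: "distinct p" "length p \<ge> 4" "induced_edges E (set p) = cycle_edges p"
    by (auto simp: is_hole_def is_cycle_def)
  note graph = simple_graphD[OF assms(1)]
  \<comment> \<open>A hole is defined by edges alone, so its vertices are placed in \<open>V\<close>
    through the edges that contain them.\<close>
  have "set p \<subseteq> V"
  proof
    fix x
    assume "x \<in> set p"
    then obtain i where "i < length p" "x = p ! i"
      by (auto simp: in_set_conv_nth)
    then have "{x, p ! (Suc i mod length p)} \<in> cycle_edges p"
      by (auto simp: cycle_edges_def)
    then show "x \<in> V"
      using p(3) graph(4) by (auto simp: induced_edges_def)
  qed
  define r where "r = ext_incidence E (set p)"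
  have "r \<in> cone_T V E"
    unfolding r_def using ext_incidence_in_cone_T[OF assms(1) \<open>set p \<subseteq> V\<close> hole_clique_card_le[OF hole]] .
  have "euler_functional V E r = 0"
    unfolding r_def using euler_functional_ext_incidence[OF assms(1) \<open>set p \<subseteq> V\<close>] p
    by (simp add: card_cycle_edges distinct_card)
  obtain v where "v \<in> set p"
    using p(2) by (cases p) auto
  have "Poly_Mapping.lookup (fst r) v = 1"
    using \<open>v \<in> set p\<close> by (simp add: r_def lookup_ext_incidence)
  then have "r \<noteq> 0"
    by auto
  \<comment> \<open>A one-vertex tree provides a starting point for the ray.\<close>
  define z where "z = ext_incidence E {v}"
  have "z \<in> poly_T V E"
    unfolding z_def using \<open>v \<in> set p\<close> \<open>set p \<subseteq> V\<close> is_tree_singleton[OF graph(3)]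
    by (intro induced_tree_in_poly_T[OF assms(1)]) (auto simp: induced_tree_def)
  then have ray: "z + t *\<^sub>R r \<in> poly_T V E" if "0 \<le> t" for t
    using that \<open>r \<in> cone_T V E\<close> \<open>euler_functional V E r = 0\<close>
    by (simp add: poly_T_iff cone_T_add cone_T_scaleR euler_functional_add euler_functional_scaleR)
  obtain B where B: "\<And>w. w \<in> poly_T V E \<Longrightarrow> norm w \<le> B"
    using assms(2) by (auto simp: bounded_iff)
  \<comment> \<open>Chosen so that \<open>t *\<^sub>R r\<close> has norm
    \<open>B + norm z + 1\<close>; subtracting \<open>norm z\<close> still leaves more than
    \<open>B\<close>.\<close>
  define t where "t = (B + norm z + 1) / norm r"
  have "0 \<le> B"
    using B[OF \<open>z \<in> poly_T V E\<close>] norm_ge_zero order_trans by blast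
  then have "0 \<le> t"
    by (simp add: t_def)
  have "norm (t *\<^sub>R r) = B + norm z + 1"
    using \<open>r \<noteq> 0\<close> \<open>0 \<le> B\<close> by (simp add: t_def)
  moreover have "norm (t *\<^sub>R r) \<le> norm (z + t *\<^sub>R r) + norm z"
    using norm_triangle_ineq4[of "z + t *\<^sub>R r" z] by simp
  ultimately show False
    using B[OF ray[OF \<open>0 \<le> t\<close>]] by simp
qed

section \<open>The linear system\<close>

definition clique_row :: "'v \<Rightarrow> 'v set \<Rightarrow> 'v row" where
  "clique_row v K = ((- Poly_Mapping.single v 1, ind_vec ((\<lambda>u. {u, v}) ` (K - {v}))), 0)"

definition clique_rows :: "'v set \<Rightarrow> 'v set set \<Rightarrow> 'v row set" where
  "clique_rows V E = (\<lambda>(v, K). clique_row v K) ` (SIGMA v:V. maximal_cliques_at V E v)"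

definition euler_rows :: "'v set \<Rightarrow> 'v set set \<Rightarrow> 'v row set" where
  "euler_rows V E = {((ind_vec V, - ind_vec E), 1), ((- ind_vec V, ind_vec E), - 1)}"

lemma sum_lookup_single:
  "finite V \<Longrightarrow> v \<in> V \<Longrightarrow> (\<Sum>u\<in>V. Poly_Mapping.lookup (Poly_Mapping.single v c) u * f u) = c * (f v :: real)"
  by (simp add: lookup_single when_def if_distrib[of "\<lambda>a. a * _"] cong: if_cong)

lemma sum_lookup_ind_vec:
  assumes "finite V" "A \<subseteq> V"
  shows "(\<Sum>u\<in>V. Poly_Mapping.lookup (ind_vec A) u * f u) = (\<Sum>u\<in>A. (f u :: real))"
proof -
  have "finite A"
    using assms finite_subset by blast
  then have "(\<Sum>u\<in>V. Poly_Mapping.lookup (ind_vec A) u * f u) = (\<Sum>u\<in>V. if u \<in> A then f u else 0)"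
    by (intro sum.cong) (auto simp: lookup_ind_vec)
  also have "\<dots> = (\<Sum>u\<in>A. f u)"
    using assms by (simp add: sum.inter_restrict[symmetric] Int_absorb1)
  finally show ?thesis .
qed

text \<open>The row sums over edges, the inequality over vertices. The map from \<open>u\<close> to
  \<open>{u, v}\<close> is injective and has its image in \<open>E\<close> because \<open>K\<close>
  is a clique, so the sums agree.\<close>

lemma satisfies_clique_row:
  assumes "simple_graph V E" "v \<in> V" "K \<in> maximal_cliques_at V E v"
  shows "satisfies_row V E z (clique_row v K) \<longleftrightarrow>
    (\<Sum>u\<in>K - {v}. Poly_Mapping.lookup (snd z) {u, v}) \<le> Poly_Mapping.lookup (fst z) v"
proof -
  have "(\<lambda>u. {u, v}) ` (K - {v}) \<subseteq> E"
    using assms(3) by (auto simp: maximal_cliques_at_def maximal_cliques_def clique_def)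
  moreover have "inj_on (\<lambda>u. {u, v}) (K - {v})"
    by (auto simp: inj_on_def doubleton_eq_iff)
  ultimately show ?thesis
    using simple_graphD(1,2)[OF assms(1)] assms(2)
    by (cases z) (simp add: satisfies_row_def clique_row_def sum_lookup_ind_vec sum.reindex
        sum_negf sum_lookup_single)
qed

lemma satisfies_sign_rows:
  assumes "simple_graph V E"
  shows "(\<forall>r\<in>sign_rows V E. satisfies_row V E z r) \<longleftrightarrow>
    (\<forall>v\<in>V. 0 \<le> Poly_Mapping.lookup (fst z) v) \<and> (\<forall>e\<in>E. 0 \<le> Poly_Mapping.lookup (snd z) e)"
proof -
  have "satisfies_row V E z ((- Poly_Mapping.single v 1, 0), 0) \<longleftrightarrow> 0 \<le> Poly_Mapping.lookup (fst z) v"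
    if "v \<in> V" for v
    using that simple_graphD(1)[OF assms]
    by (cases z) (simp add: satisfies_row_def sum_negf sum_lookup_single)
  moreover have "satisfies_row V E z ((0, - Poly_Mapping.single e 1), 0) \<longleftrightarrow> 0 \<le> Poly_Mapping.lookup (snd z) e"
    if "e \<in> E" for e
    using that simple_graphD(2)[OF assms]
    by (cases z) (simp add: satisfies_row_def sum_negf sum_lookup_single)
  ultimately show ?thesis
    unfolding sign_rows_def by blast
qed

lemma satisfies_euler_rows:
  assumes "simple_graph V E"
  shows "(\<forall>r\<in>euler_rows V E. satisfies_row V E z r) \<longleftrightarrow> euler_functional V E z = 1"
  using simple_graphD(1,2)[OF assms]
  by (cases z) (auto simp: satisfies_row_def euler_rows_def euler_functional_def sum_lookup_ind_vec sum_negf)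

lemma finite_maximal_cliques: "finite V \<Longrightarrow> finite (maximal_cliques V E)"
  by (rule finite_subset[of _ "Pow V"]) (auto simp: maximal_cliques_def)

lemma solution_set_eq_poly_T:
  assumes "simple_graph V E"
  shows "solution_set V E (sign_rows V E \<union> (clique_rows V E \<union> euler_rows V E)) = poly_T V E"
proof -
  have "(\<forall>r\<in>clique_rows V E. satisfies_row V E z r) \<longleftrightarrow>
      (\<forall>v\<in>V. \<forall>K\<in>maximal_cliques_at V E v.
        (\<Sum>u\<in>K - {v}. Poly_Mapping.lookup (snd z) {u, v}) \<le> Poly_Mapping.lookup (fst z) v)" for z
    using satisfies_clique_row[OF assms] by (auto simp: clique_rows_def)
  then show ?thesis
    using satisfies_sign_rows[OF assms] satisfies_euler_rows[OF assms]
    by (auto simp: solution_set_def poly_T_iff cone_T_iff ball_Un)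
qed

text \<open>One row per incident pair of vertex and maximal clique, plus the two halves of the
  equation. Those two are absorbed into the constant 3 because the product is at least 1 for
  nonempty \<open>V\<close>; for empty \<open>V\<close> it would be 0 while they remain.\<close>

lemma card_nonsign_rows_le:
  assumes "finite V" "V \<noteq> {}"
  shows "card (clique_rows V E \<union> euler_rows V E) \<le> 3 * (card V * card (maximal_cliques V E))"
proof -
  note fin = finite_maximal_cliques[OF assms(1), of E]
  have "(SIGMA v:V. maximal_cliques_at V E v) \<subseteq> V \<times> maximal_cliques V E"
    by (auto simp: maximal_cliques_at_def)
  then have "card (SIGMA v:V. maximal_cliques_at V E v) \<le> card (V \<times> maximal_cliques V E)"
    using assms(1) fin by (intro card_mono) auto
  moreover have "card (clique_rows V E) \<le> card (SIGMA v:V. maximal_cliques_at V E v)"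
    unfolding clique_rows_def using assms(1) fin
    by (intro card_image_le finite_SigmaI) (auto simp: maximal_cliques_at_def)
  ultimately have "card (clique_rows V E) \<le> card V * card (maximal_cliques V E)"
    by (simp add: card_cartesian_product)
  moreover have "card (euler_rows V E) \<le> 2"
    by (simp add: euler_rows_def card_insert_le_m1)
  moreover have "maximal_cliques V E \<noteq> {}"
    using clique_subset_maximal_clique[OF assms(1), of "{}" E] by auto
  then have "1 \<le> card V * card (maximal_cliques V E)"
    using assms fin by (simp add: Suc_le_eq card_gt_0_iff)
  ultimately show ?thesis
    using card_Un_le[of "clique_rows V E" "euler_rows V E"] by linarith
qed

theorem corollary1p3:
  shows
    "(\<forall>(V :: 'v set) E. simple_graph V E \<longrightarrow>
        (chordal E \<longleftrightarrow> induced_tree_polytope V E = poly_T V E) \<and>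
        (induced_tree_polytope V E = poly_T V E \<longleftrightarrow> bounded (poly_T V E))) \<and>
     (\<exists>c :: real. \<forall>(V :: 'v set) E. simple_graph V E \<longrightarrow> V \<noteq> {} \<longrightarrow> chordal E \<longrightarrow>
        (\<exists>S. finite S \<and> solution_set V E S = poly_T V E \<and>
             real (system_size V E S) \<le> c * real (card V * card (maximal_cliques V E))))"
proof (intro conjI allI impI)
  fix V :: "'v set" and E
  assume graph: "simple_graph V E"
  have 1: "induced_tree_polytope V E = poly_T V E" if "chordal E"
    using induced_tree_polytope_subset_poly_T[OF graph] chordal_poly_T_subset[OF graph that] by simp
  have 2: "bounded (poly_T V E)" if "induced_tree_polytope V E = poly_T V E"
    using bounded_induced_tree_polytope[OF graph] that by simp
  have 3: "chordal E" if "bounded (poly_T V E)"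
    using bounded_poly_T_imp_chordal[OF graph that] .
  show "chordal E \<longleftrightarrow> induced_tree_polytope V E = poly_T V E"
    "induced_tree_polytope V E = poly_T V E \<longleftrightarrow> bounded (poly_T V E)"
    using 1 2 3 by blast+
next
  show "\<exists>c :: real. \<forall>(V :: 'v set) E. simple_graph V E \<longrightarrow> V \<noteq> {} \<longrightarrow> chordal E \<longrightarrow>
        (\<exists>S. finite S \<and> solution_set V E S = poly_T V E \<and>
             real (system_size V E S) \<le> c * real (card V * card (maximal_cliques V E)))"
  proof (intro exI[of _ 3] allI impI)
    fix V :: "'v set" and E
    assume graph: "simple_graph V E" and "V \<noteq> {}"
    let ?S = "clique_rows V E \<union> euler_rows V E"
    have fin: "finite V" "finite E"
      using simple_graphD[OF graph] by auto
    then have "finite ?S"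
      using finite_maximal_cliques[of V E]
      by (auto simp: clique_rows_def euler_rows_def maximal_cliques_at_def)
    moreover have "sign_rows V E = (\<lambda>v. ((- Poly_Mapping.single v 1, 0), 0)) ` V \<union>
        (\<lambda>e. ((0, - Poly_Mapping.single e 1), 0)) ` E"
      by (auto simp: sign_rows_def)
    then have "finite (sign_rows V E)"
      using fin by simp
    \<comment> \<open>In general only an inequality: for an isolated vertex \<open>v\<close>, the
      row of the maximal clique \<open>{v}\<close> is itself a sign row.\<close>
    moreover have "system_size V E (sign_rows V E \<union> ?S) \<le> card ?S"
      unfolding system_size_def using \<open>finite ?S\<close> by (intro card_mono) auto
    then have "system_size V E (sign_rows V E \<union> ?S) \<le> 3 * (card V * card (maximal_cliques V E))"
      using card_nonsign_rows_le[OF fin(1) \<open>V \<noteq> {}\<close>, of E] by linarith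
    then have "real (system_size V E (sign_rows V E \<union> ?S)) \<le>
        3 * real (card V * card (maximal_cliques V E))"
      by (metis of_nat_le_iff of_nat_mult of_nat_numeral)
    ultimately show "\<exists>S. finite S \<and> solution_set V E S = poly_T V E \<and>
        real (system_size V E S) \<le> 3 * real (card V * card (maximal_cliques V E))"
      using solution_set_eq_poly_T[OF graph] by (intro exI[of _ "sign_rows V E \<union> ?S"]) simp
  qed
qed

end
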